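(* Let $G$ be a 2-connected simple graph and let $T\subseteq G$ be a spanning tree. Then $G$ has an ear decomposition $R_1,\dots,R_m$ such that $|E(R_i)\setminus E(T)|=1$ for every $i\in\{1,\dots,m\}$.
   Context: Graphs are finite and undirected. A graph is 2-connected if it is connected, has at least three vertices, and has no cut-vertex. An ear decomposition of a graph $G$ is a list of subgraphs $R_1,\dots,R_m$ such that (1) $E(G)=E(R_1)\cup\cdots\cup E(R_m)$; (2) $R_1$ is a cycle; and (3) for each $i>1$, $R_i$ is a path (with two distinct endpoints) that meets $R_1\cup\cdots\cup R_{i-1}$ exactly at its two endpoints: both endpoints belong to $R_1\cup\cdots\cup R_{i-1}$, and $R_i$ shares no other vertex and no edge with it. *)

theory Defs
  imports Main
begin

datatype 'a graph = Graph (verts: "'a set") (edges: "'a set set")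

definition simple_graph :: "'a graph \<Rightarrow> bool" where
  "simple_graph G \<longleftrightarrow> finite (verts G) \<and>
     (\<forall>e\<in>edges G. \<exists>u v. u \<in> verts G \<and> v \<in> verts G \<and> u \<noteq> v \<and> e = {u, v})"

definition subgraph :: "'a graph \<Rightarrow> 'a graph \<Rightarrow> bool" where
  "subgraph H G \<longleftrightarrow> simple_graph H \<and> verts H \<subseteq> verts G \<and> edges H \<subseteq> edges G"

definition graph_Union :: "'a graph set \<Rightarrow> 'a graph" where
  "graph_Union \<G> = Graph (\<Union>H\<in>\<G>. verts H) (\<Union>H\<in>\<G>. edges H)"

definition del_vertex :: "'a graph \<Rightarrow> 'a \<Rightarrow> 'a graph" where
  "del_vertex G v = Graph (verts G - {v}) {e \<in> edges G. v \<notin> e}"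

definition linked :: "'a graph \<Rightarrow> 'a \<Rightarrow> 'a \<Rightarrow> bool" where
  "linked G = (\<lambda>x y. {x, y} \<in> edges G)\<^sup>*\<^sup>*"

definition connected_graph :: "'a graph \<Rightarrow> bool" where
  "connected_graph G \<longleftrightarrow> verts G \<noteq> {} \<and> (\<forall>x\<in>verts G. \<forall>y\<in>verts G. linked G x y)"

(* A cut-vertex separates two other vertices lying in the same component. *)
definition cut_vertex :: "'a graph \<Rightarrow> 'a \<Rightarrow> bool" where
  "cut_vertex G v \<longleftrightarrow> v \<in> verts G \<and>
     (\<exists>x\<in>verts G - {v}. \<exists>y\<in>verts G - {v}. linked G x y \<and> \<not> linked (del_vertex G v) x y)"

definition two_connected :: "'a graph \<Rightarrow> bool" where
  "two_connected G \<longleftrightarrow>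
     connected_graph G \<and> 3 \<le> card (verts G) \<and> (\<nexists>v. cut_vertex G v)"

definition consecutive_edges :: "'a list \<Rightarrow> 'a set set" where
  "consecutive_edges xs = {{xs ! i, xs ! Suc i} |i. Suc i < length xs}"

(* Paths and cycles are graphs; the list enumerates the vertices in order. *)
definition is_path :: "'a graph \<Rightarrow> 'a \<Rightarrow> 'a \<Rightarrow> bool" where
  "is_path P a b \<longleftrightarrow> (\<exists>xs. xs \<noteq> [] \<and> distinct xs \<and> hd xs = a \<and> last xs = b \<and>
     P = Graph (set xs) (consecutive_edges xs))"

definition is_cycle :: "'a graph \<Rightarrow> bool" where
  "is_cycle C \<longleftrightarrow> (\<exists>xs. 3 \<le> length xs \<and> distinct xs \<and>
     C = Graph (set xs) (insert {last xs, hd xs} (consecutive_edges xs)))"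

definition tree :: "'a graph \<Rightarrow> bool" where
  "tree T \<longleftrightarrow> simple_graph T \<and> connected_graph T \<and> (\<nexists>C. subgraph C T \<and> is_cycle C)"

definition spanning_tree :: "'a graph \<Rightarrow> 'a graph \<Rightarrow> bool" where
  "spanning_tree T G \<longleftrightarrow> subgraph T G \<and> verts T = verts G \<and> tree T"

(* The ears R_1, ..., R_m are the list entries Rs ! 0, ..., Rs ! (m - 1). *)
definition ear_decomposition :: "'a graph \<Rightarrow> 'a graph list \<Rightarrow> bool" where
  "ear_decomposition G Rs \<longleftrightarrow>
     Rs \<noteq> [] \<and>
     (\<forall>R\<in>set Rs. subgraph R G) \<and>
     edges G = (\<Union>R\<in>set Rs. edges R) \<and>
     is_cycle (Rs ! 0) \<and>
     (\<forall>i. 0 < i \<and> i < length Rs \<longrightarrow>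
        (\<exists>a b. a \<noteq> b \<and> is_path (Rs ! i) a b \<and>
          verts (Rs ! i) \<inter> verts (graph_Union (set (take i Rs))) = {a, b} \<and>
          edges (Rs ! i) \<inter> edges (graph_Union (set (take i Rs))) = {}))"

end

theory Submission
  imports Defs
begin

text \<open>
  Root \<open>T\<close> at a vertex \<open>a\<close> and grow a subgraph \<open>H\<close> of \<open>G\<close> that contains, with every vertex, the
  whole tree path from that vertex to the root. Every vertex outside \<open>H\<close> then climbs along tree
  edges to a first ancestor in \<open>H\<close>, its \<^emph>\<open>foot\<close>, and the tree edges outside \<open>H\<close> fall into branches,
  one for each foot. If some vertex is outside \<open>H\<close>, let \<open>r\<close> be its foot. As \<open>r\<close> is not a
  cut-vertex, an edge \<open>xy\<close> of \<open>G\<close> avoiding \<open>r\<close> leaves the branch of \<open>r\<close> (\<open>exists_crossing_edge\<close>);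
  tree edges stay in their branch, so \<open>xy\<close> is not in \<open>T\<close>. Climbing from both of its ends gives two
  disjoint tree paths, because the feet differ, and together with \<open>xy\<close> they form an ear with a
  single edge outside \<open>T\<close> (\<open>exists_long_ear\<close>). Adding the ear keeps \<open>H\<close> closed under taking parents.
  Once \<open>H\<close> spans \<open>G\<close> it contains \<open>T\<close>, and each remaining edge is an ear by itself.

  The first cycle comes from the same construction: start with \<open>H\<close> consisting of one tree edge
  \<open>ab\<close>. An ear of this \<open>H\<close> runs from one end of \<open>ab\<close> to the other through a new vertex, so it closes
  up with \<open>ab\<close> to a cycle, and \<open>ab\<close> lies in \<open>T\<close>.
\<close>

section \<open>Consecutive edges of vertex lists\<close>

lemma consecutive_edges_Nil [simp]: "consecutive_edges [] = {}"
  and consecutive_edges_single [simp]: "consecutive_edges [x] = {}"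
  by (auto simp: consecutive_edges_def)

lemma consecutive_edges_Cons:
  assumes "xs \<noteq> []"
  shows "consecutive_edges (x # xs) = insert {x, hd xs} (consecutive_edges xs)"
proof -
  have "{x, hd xs} \<in> consecutive_edges (x # xs)"
    using assms unfolding consecutive_edges_def
    by (auto intro!: exI[of _ 0] simp: hd_conv_nth)
  moreover have "e \<in> consecutive_edges (x # xs)" if "e \<in> consecutive_edges xs" for e
  proof -
    from that obtain i where "e = {xs ! i, xs ! Suc i}" "Suc i < length xs"
      unfolding consecutive_edges_def by blast
    then show ?thesis
      unfolding consecutive_edges_def by (auto intro!: exI[of _ "Suc i"])
  qed
  moreover have "e = {x, hd xs} \<or> e \<in> consecutive_edges xs"
    if "e \<in> consecutive_edges (x # xs)" for e
  proof -
    from that obtain i where i: "e = {(x # xs) ! i, (x # xs) ! Suc i}" "Suc i < length (x # xs)"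
      unfolding consecutive_edges_def by blast
    then show ?thesis
      using assms by (cases i) (auto simp: hd_conv_nth consecutive_edges_def)
  qed
  ultimately show ?thesis by blast
qed

lemma consecutive_edges_append:
  assumes "xs \<noteq> []" "ys \<noteq> []"
  shows "consecutive_edges (xs @ ys) =
    insert {last xs, hd ys} (consecutive_edges xs \<union> consecutive_edges ys)"
  using assms
proof (induction xs)
  case (Cons x xs)
  then show ?case
    by (cases "xs = []") (auto simp: consecutive_edges_Cons)
qed simp

lemma consecutive_edges_rev: "consecutive_edges (rev xs) = consecutive_edges xs"
proof (induction xs)
  case (Cons x xs)
  then show ?case
    by (cases "xs = []")
      (auto simp: consecutive_edges_append consecutive_edges_Cons last_rev insert_commute)
qed simp

lemma consecutive_edges_simple:
  assumes "distinct xs" "e \<in> consecutive_edges xs"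
  shows "\<exists>u v. u \<in> set xs \<and> v \<in> set xs \<and> u \<noteq> v \<and> e = {u, v}"
proof -
  from assms(2) obtain i where i: "e = {xs ! i, xs ! Suc i}" "Suc i < length xs"
    unfolding consecutive_edges_def by blast
  moreover have "xs ! i \<noteq> xs ! Suc i"
    using i(2) assms(1) by (simp add: nth_eq_iff_index_eq)
  ultimately show ?thesis
    by (metis Suc_lessD nth_mem)
qed

lemma closed_path_simple:
  assumes "distinct xs" "xs \<noteq> []" "hd xs \<noteq> last xs"
  shows "simple_graph (Graph (set xs) (insert {last xs, hd xs} (consecutive_edges xs)))"
proof -
  have "\<exists>u v. u \<in> set xs \<and> v \<in> set xs \<and> u \<noteq> v \<and> {last xs, hd xs} = {u, v}"
    using assms(2,3) by (metis hd_in_set last_in_set)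
  then show ?thesis
    using consecutive_edges_simple[OF assms(1)] unfolding simple_graph_def by simp
qed

lemma linked_imp_path:
  assumes "linked G x y"
  shows "\<exists>xs. xs \<noteq> [] \<and> distinct xs \<and> hd xs = x \<and> last xs = y \<and> consecutive_edges xs \<subseteq> edges G"
  using assms unfolding linked_def
proof (induction rule: converse_rtranclp_induct)
  case base
  show ?case by (rule exI[of _ "[y]"]) simp
next
  case (step x x')
  then obtain xs where xs: "xs \<noteq> []" "distinct xs" "hd xs = x'" "last xs = y"
    "consecutive_edges xs \<subseteq> edges G" by blast
  show ?case
  proof (cases "x \<in> set xs")
    \<comment> \<open>If the path already visits \<open>x\<close>, its part from \<open>x\<close> on is the required path.\<close>
    case True
    then obtain us vs where "xs = us @ x # vs" by (meson split_list)
    then show ?thesis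
      using xs by (intro exI[of _ "x # vs"]) (cases "us = []", auto simp: consecutive_edges_append)
  next
    case False
    then show ?thesis
      using xs step.hyps by (intro exI[of _ "x # xs"]) (auto simp: consecutive_edges_Cons)
  qed
qed

lemma simple_graph_edgeD:
  assumes "simple_graph G" "{x, y} \<in> edges G"
  shows "x \<in> verts G" "y \<in> verts G" "x \<noteq> y"
proof -
  obtain u v where "u \<in> verts G" "v \<in> verts G" "u \<noteq> v" "{x, y} = {u, v}"
    using assms unfolding simple_graph_def by blast
  then show "x \<in> verts G" "y \<in> verts G" "x \<noteq> y"
    by (auto simp: doubleton_eq_iff)
qed

lemma simple_graph_finite_edges:
  assumes "simple_graph G"
  shows "finite (edges G)"
proof (rule finite_subset)
  show "edges G \<subseteq> Pow (verts G)" using assms unfolding simple_graph_def by fast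
qed (use assms in \<open>simp add: simple_graph_def\<close>)

lemma linked_sym: "linked G x y \<Longrightarrow> linked G y x"
  unfolding linked_def
proof (induction rule: rtranclp_induct)
  case (step y z)
  then show ?case by (metis (no_types, lifting) converse_rtranclp_into_rtranclp insert_commute)
qed simp

lemma linked_trans: "linked G x y \<Longrightarrow> linked G y z \<Longrightarrow> linked G x z"
  unfolding linked_def by (rule rtranclp_trans)

section \<open>Rooting a tree\<close>

text \<open>
  The parent of \<open>v\<close> is a neighbour of smaller distance from the root. The parent edges alone
  link any two vertices, so a further edge \<open>uv\<close> would close a path of parent edges from \<open>u\<close> to \<open>v\<close> to
  a cycle.
\<close>
lemma tree_parent_function:
  assumes "tree T" and a: "a \<in> verts T"
  obtains p and d :: "'a \<Rightarrow> nat" where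
    "\<And>v. v \<in> verts T \<Longrightarrow> v \<noteq> a \<Longrightarrow> d (p v) < d v"
    "edges T = (\<lambda>v. {v, p v}) ` (verts T - {a})"
proof -
  have simple: "simple_graph T" and conn: "connected_graph T"
    and acyclic: "\<nexists>C. subgraph C T \<and> is_cycle C"
    using assms(1) unfolding tree_def by auto
  define R where "R = (\<lambda>x y. {x, y} \<in> edges T)"
  define d where "d v = (LEAST n. (R ^^ n) a v)" for v
  define p where "p v = (SOME w. {v, w} \<in> edges T \<and> d w < d v)" for v
  have p: "{v, p v} \<in> edges T \<and> d (p v) < d v" if v: "v \<in> verts T" "v \<noteq> a" for v
  proof -
    have "R\<^sup>*\<^sup>* a v"
      using conn a v(1) unfolding connected_graph_def linked_def R_def by blast
    then have "\<exists>n. (R ^^ n) a v" by (simp add: rtranclp_power)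
    then have *: "(R ^^ d v) a v" unfolding d_def by (rule LeastI_ex)
    then obtain n where n: "d v = Suc n" using v(2) by (cases "d v") auto
    then obtain w where w: "(R ^^ n) a w" "R w v" using * by auto
    then have "d w \<le> n" unfolding d_def by (blast intro: Least_le)
    then have "\<exists>w. {v, w} \<in> edges T \<and> d w < d v"
      using w n by (auto simp: R_def insert_commute intro!: exI[of _ w])
    then show ?thesis unfolding p_def by (rule someI_ex)
  qed
  define P where "P = Graph (verts T) ((\<lambda>v. {v, p v}) ` (verts T - {a}))"
  have P_sub: "edges P \<subseteq> edges T" using p by (auto simp: P_def)
  have to_root: "v \<in> verts T \<Longrightarrow> linked P v a" for v
  proof (induction "d v" arbitrary: v rule: less_induct)
    case less
    show ?case
    proof (cases "v = a")
      case True
      then show ?thesis by (simp add: linked_def)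
    next
      case False
      have "p v \<in> verts T" using p[OF less.prems False] simple simple_graph_edgeD by metis
      then have "linked P (p v) a" using p[OF less.prems False] less.hyps by blast
      moreover have "{v, p v} \<in> edges P" using less.prems False by (auto simp: P_def)
      ultimately show ?thesis unfolding linked_def by (meson converse_rtranclp_into_rtranclp)
    qed
  qed
  have "edges T \<subseteq> edges P"
  proof
    fix e assume e: "e \<in> edges T"
    obtain u v where uv: "u \<in> verts T" "v \<in> verts T" "u \<noteq> v" "e = {u, v}"
      using simple e unfolding simple_graph_def by blast
    show "e \<in> edges P"
    proof (rule ccontr)
      assume not: "e \<notin> edges P"
      have "linked P u v" using to_root uv linked_sym linked_trans by metis
      then obtain xs where xs: "xs \<noteq> []" "distinct xs" "hd xs = u" "last xs = v"
        "consecutive_edges xs \<subseteq> edges P" using linked_imp_path by metis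
      \<comment> \<open>A path with only two vertices would be the edge \<open>e\<close> itself.\<close>
      have len: "3 \<le> length xs"
      proof (rule ccontr)
        assume "\<not> 3 \<le> length xs"
        moreover have "length xs \<noteq> 0" using xs(1) by simp
        ultimately have "length xs = 1 \<or> length xs = 2" by linarith
        then have "xs = [u] \<and> u = v \<or> xs = [u, v]"
          using xs(3,4) by (auto simp: length_Suc_conv numeral_2_eq_2)
        then show False using xs(5) uv not by (auto simp: consecutive_edges_Cons)
      qed
      define C where "C = Graph (set xs) (insert {last xs, hd xs} (consecutive_edges xs))"
      have "is_cycle C" using len xs(2) unfolding is_cycle_def C_def by blast
      moreover have "subgraph C T"
      proof -
        have E: "edges C \<subseteq> edges T"
          using xs e uv P_sub by (auto simp: C_def insert_commute)
        have "w \<in> verts T" if w: "w \<in> set xs" for w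
        proof -
          obtain ys zs where "xs = ys @ w # zs" using w by (meson split_list)
          then have "\<exists>f\<in>consecutive_edges xs. w \<in> f"
            using len by (cases "ys = []"; cases "zs = []")
              (auto simp: consecutive_edges_append consecutive_edges_Cons)
          then show ?thesis
            using xs(5) P_sub simple unfolding simple_graph_def by fast
        qed
        moreover have "simple_graph C"
          unfolding C_def using closed_path_simple xs uv(3) by blast
        ultimately show ?thesis
          using E unfolding subgraph_def by (auto simp: C_def)
      qed
      ultimately show False using acyclic by blast
    qed
  qed
  then have "edges T = (\<lambda>v. {v, p v}) ` (verts T - {a})"
    using P_sub by (auto simp: P_def)
  then show thesis using that p by blast
qed

section \<open>Climbing towards the root\<close>

text \<open>
  A relation rather than a function, because iterating an arbitrary \<open>p\<close> need not reach \<open>S\<close>. The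
  last entry of the list is the foot of \<open>v\<close>.
\<close>
inductive climb :: "('a \<Rightarrow> 'a) \<Rightarrow> 'a set \<Rightarrow> 'a \<Rightarrow> 'a list \<Rightarrow> bool" for p S where
  stop: "v \<in> S \<Longrightarrow> climb p S v [v]"
| step: "v \<notin> S \<Longrightarrow> climb p S (p v) xs \<Longrightarrow> climb p S v (v # xs)"

lemma climb_unique: "climb p S v xs \<Longrightarrow> climb p S v ys \<Longrightarrow> xs = ys"
proof (induction arbitrary: ys rule: climb.induct)
  case (stop v)
  from stop(2,1) show ?case by cases auto
next
  case (step v xs)
  from step(4,1) show ?case by cases (use step.IH in auto)
qed

lemma climb_ends:
  "climb p S v xs \<Longrightarrow> xs \<noteq> [] \<and> hd xs = v \<and> last xs \<in> S \<and> set xs \<inter> S = {last xs}"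
  by (induction rule: climb.induct) auto

text \<open>Two climbs that meet coincide from there on; hence climbs to different feet are disjoint.\<close>
lemma climb_through_same_foot:
  "climb p S v xs \<Longrightarrow> w \<in> set xs \<Longrightarrow> \<exists>ys. climb p S w ys \<and> last ys = last xs"
proof (induction rule: climb.induct)
  case (step v xs)
  show ?case
  proof (cases "w = v")
    case True
    with step.hyps show ?thesis by (blast intro: climb.step)
  next
    case False
    with step show ?thesis using climb_ends by fastforce
  qed
qed (auto intro: climb.stop)

lemma climb_edges:
  "climb p S v xs \<Longrightarrow> consecutive_edges xs = (\<lambda>w. {w, p w}) ` (set xs - S)"
proof (induction rule: climb.induct)
  case (step v xs)
  then show ?case using climb_ends[OF step.hyps(2)]
    by (simp add: consecutive_edges_Cons insert_Diff_if)
qed auto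

section \<open>Ears over a subgraph closed under taking parents\<close>

locale rooted_spanning_tree =
  fixes G T :: "'a graph" and a :: 'a and p :: "'a \<Rightarrow> 'a" and d :: "'a \<Rightarrow> nat"
  assumes simple: "simple_graph G"
    and tree_edges_in: "edges T \<subseteq> edges G"
    and root_in: "a \<in> verts G"
    and parent_less: "\<And>v. v \<in> verts G \<Longrightarrow> v \<noteq> a \<Longrightarrow> d (p v) < d v"
    and tree_edges: "edges T = (\<lambda>v. {v, p v}) ` (verts G - {a})"
begin

lemma parent_in: "v \<in> verts G \<Longrightarrow> v \<noteq> a \<Longrightarrow> p v \<in> verts G"
  by (rule simple_graph_edgeD(2)[OF simple, of v]) (use tree_edges tree_edges_in in auto)

lemma climb_exists:
  assumes "a \<in> S" "v \<in> verts G"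
  shows "\<exists>xs. climb p S v xs"
  using assms(2)
proof (induction "d v" arbitrary: v rule: less_induct)
  case less
  show ?case
  proof (cases "v \<in> S")
    case True
    then show ?thesis by (blast intro: climb.stop)
  next
    case False
    then have "v \<noteq> a" using assms(1) by blast
    then obtain xs where "climb p S (p v) xs"
      using less parent_less parent_in by blast
    then show ?thesis using False by (blast intro: climb.step)
  qed
qed

lemma climb_distinct_in:
  assumes "climb p S v xs" "a \<in> S" "v \<in> verts G"
  shows "distinct xs \<and> set xs \<subseteq> verts G \<and> (\<forall>w\<in>set xs. d w \<le> d v)"
  using assms(1,3)
proof (induction rule: climb.induct)
  case (step v xs)
  have "v \<noteq> a" using step.hyps(1) assms(2) by blast
  then have pv: "d (p v) < d v" "p v \<in> verts G" using step.prems parent_less parent_in by blast+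
  then have IH: "distinct xs" "set xs \<subseteq> verts G" "\<forall>w\<in>set xs. d w \<le> d (p v)"
    using step.IH by blast+
  then have "v \<notin> set xs" "\<forall>w\<in>set xs. d w \<le> d v"
    using pv(1) by (meson not_le less_imp_le order_trans)+
  then show ?case using step.prems IH by simp
qed auto

text \<open>
  The subgraphs over which ears are built. Since edges of \<open>H\<close> join vertices of \<open>H\<close>, the last condition
  makes the vertex set closed under \<open>p\<close>. A second vertex is needed for an ear to have
  two ends.
\<close>
definition ancestral :: "'a graph \<Rightarrow> bool" where
  "ancestral H \<longleftrightarrow> subgraph H G \<and> a \<in> verts H \<and> verts H \<noteq> {a} \<and>
     (\<forall>v\<in>verts H - {a}. {v, p v} \<in> edges H)"

definition ear :: "'a graph \<Rightarrow> 'a list \<Rightarrow> bool" where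
  "ear H zs \<longleftrightarrow> zs \<noteq> [] \<and> distinct zs \<and> hd zs \<noteq> last zs \<and> set zs \<subseteq> verts G \<and>
     consecutive_edges zs \<subseteq> edges G \<and> set zs \<inter> verts H = {hd zs, last zs} \<and>
     consecutive_edges zs \<inter> edges H = {} \<and> card (consecutive_edges zs - edges T) = 1"

definition add_path :: "'a graph \<Rightarrow> 'a list \<Rightarrow> 'a graph" where
  "add_path H zs = Graph (verts H \<union> set zs) (edges H \<union> consecutive_edges zs)"

lemma add_path_subgraph:
  assumes H: "subgraph H G"
    and zs: "distinct zs" "set zs \<subseteq> verts G" "consecutive_edges zs \<subseteq> edges G"
  shows "subgraph (add_path H zs) G"
proof -
  have simH: "simple_graph H" using H unfolding subgraph_def by blast
  have "\<exists>u v. u \<in> verts H \<union> set zs \<and> v \<in> verts H \<union> set zs \<and> u \<noteq> v \<and> e = {u, v}"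
    if "e \<in> edges H \<union> consecutive_edges zs" for e
    using that
  proof
    assume "e \<in> edges H"
    then show ?thesis using simH unfolding simple_graph_def by fast
  next
    assume "e \<in> consecutive_edges zs"
    then show ?thesis using consecutive_edges_simple[OF zs(1)] by fast
  qed
  then have "simple_graph (add_path H zs)"
    using simH unfolding simple_graph_def add_path_def by simp
  then show ?thesis using H zs unfolding subgraph_def by (simp add: add_path_def)
qed

lemma ancestral_parent:
  assumes "ancestral H" "v \<in> verts H" "v \<noteq> a"
  shows "p v \<in> verts H"
proof (rule simple_graph_edgeD(2))
  show "simple_graph H" using assms(1) unfolding ancestral_def subgraph_def by simp
  show "{v, p v} \<in> edges H" using assms unfolding ancestral_def by simp
qed

text \<open>Tree edges outside \<open>H\<close> do not change the foot, so an edge between branches is not a tree edge.\<close>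
lemma tree_edge_same_foot:
  assumes H: "ancestral H" and e: "{x, y} \<in> edges T" and x: "x \<notin> verts H"
    and cx: "climb p (verts H) x xs" and cy: "climb p (verts H) y ys"
  shows "last xs = last ys"
proof -
  have aH: "a \<in> verts H" using H unfolding ancestral_def by blast
  have up: "last us = last ws"
    if "v \<notin> verts H" "climb p (verts H) v us" "climb p (verts H) (p v) ws" for v us ws
  proof -
    have "us = v # ws" using climb_unique[OF that(2) climb.step[OF that(1,3)]] .
    then show ?thesis using climb_ends[OF that(3)] by simp
  qed
  obtain v where v: "v \<in> verts G" "v \<noteq> a" "{x, y} = {v, p v}" using e tree_edges by auto
  then consider "v = x" "y = p x" | "v = y" "x = p y" by (auto simp: doubleton_eq_iff)
  then show ?thesis
  proof cases
    case 1
    then show ?thesis using up[OF x cx] cy by simp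
  next
    case 2
    \<comment> \<open>The child \<open>y\<close> is outside \<open>H\<close> because its parent \<open>x\<close> is.\<close>
    then have "y \<notin> verts H" using x v(2) ancestral_parent[OF H] by blast
    then show ?thesis using up[OF _ cy] cx 2 by metis
  qed
qed

text \<open>
  If the foot \<open>r\<close> of an outside vertex is deleted, that vertex is still linked to the rest
  of \<open>H\<close>, and the link has to leave the branch of \<open>r\<close> somewhere.
\<close>
lemma exists_crossing_edge:
  assumes two: "two_connected G" and H: "ancestral H" and c: "c \<in> verts G" "c \<notin> verts H"
  shows "\<exists>x y xs ys. {x, y} \<in> edges G \<and> x \<notin> verts H \<and>
    climb p (verts H) x xs \<and> climb p (verts H) y ys \<and> last xs \<noteq> last ys"
proof -
  have aH: "a \<in> verts H" and HG: "verts H \<subseteq> verts G"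
    using H unfolding ancestral_def subgraph_def by auto
  obtain cs where cs: "climb p (verts H) c cs" using climb_exists[OF aH c(1)] by blast
  define r where "r = last cs"
  have r: "r \<in> verts H" using climb_ends[OF cs] r_def by simp
  obtain s where s: "s \<in> verts H" "s \<noteq> r"
    using H r unfolding ancestral_def by (cases "r = a") auto
  define B where "B = {v. v \<notin> verts H \<and> (\<exists>xs. climb p (verts H) v xs \<and> last xs = r)}"
  have cB: "c \<in> B" and sB: "s \<notin> B" using c cs s unfolding B_def r_def by auto
  have linked: "linked G c s"
    using two c s HG unfolding two_connected_def connected_graph_def by blast
  have not_cut: "\<not> cut_vertex G r" using two unfolding two_connected_def by blast
  have "linked (del_vertex G r) c s"
  proof -
    have "r \<in> verts G" "c \<in> verts G - {r}" "s \<in> verts G - {r}" using r s c HG by auto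
    with linked not_cut show ?thesis unfolding cut_vertex_def by blast
  qed
  then have "\<exists>x y. x \<in> B \<and> y \<notin> B \<and> {x, y} \<in> edges (del_vertex G r)"
    unfolding linked_def
  proof (rule contrapos_pp)
    assume closed: "\<nexists>x y. x \<in> B \<and> y \<notin> B \<and> {x, y} \<in> edges (del_vertex G r)"
    have "s \<in> B" if "(\<lambda>x y. {x, y} \<in> edges (del_vertex G r))\<^sup>*\<^sup>* c s"
      using that
    proof (induction rule: rtranclp_induct)
      case base
      show ?case by (rule cB)
    next
      case (step y z)
      then show ?case using closed by metis
    qed
    then show "\<not> (\<lambda>x y. {x, y} \<in> edges (del_vertex G r))\<^sup>*\<^sup>* c s" using sB by blast
  qed
  then obtain x y where xy: "x \<in> B" "y \<notin> B" "{x, y} \<in> edges G" "r \<noteq> y"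
    by (auto simp: del_vertex_def)
  have "y \<in> verts G" using simple_graph_edgeD[OF simple xy(3)] by blast
  then obtain ys where ys: "climb p (verts H) y ys" using climb_exists[OF aH] by blast
  have "last ys \<noteq> r"
  proof (cases "y \<in> verts H")
    case True
    then have "ys = [y]" using climb_unique[OF ys climb.stop] by blast
    then show ?thesis using xy(4) by simp
  next
    case False
    then show ?thesis using xy(2) ys unfolding B_def by blast
  qed
  moreover obtain xs where "x \<notin> verts H" "climb p (verts H) x xs" "last xs = r"
    using xy(1) unfolding B_def by blast
  ultimately show ?thesis using xy(3) ys by metis
qed

text \<open>
  A crossing edge \<open>xy\<close>, with the climbs from both of its ends. The path has an inner vertex
  because \<open>x\<close> is outside \<open>H\<close>; this is what lets the first ear close up to a cycle.
\<close>
lemma exists_long_ear: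
  assumes "two_connected G" and H: "ancestral H" and "\<not> verts G \<subseteq> verts H"
  shows "\<exists>zs. ear H zs \<and> 3 \<le> length zs \<and> ancestral (add_path H zs)"
proof -
  have aH: "a \<in> verts H" and HG: "verts H \<subseteq> verts G" and subH: "subgraph H G"
    using H unfolding ancestral_def subgraph_def by auto
  have simH: "simple_graph H" using subH unfolding subgraph_def by blast
  obtain x y xs ys where xy: "{x, y} \<in> edges G" and x: "x \<notin> verts H"
    and cx: "climb p (verts H) x xs" and cy: "climb p (verts H) y ys"
    and feet: "last xs \<noteq> last ys"
    using exists_crossing_edge[OF assms(1) H] assms(3) by blast
  note X = climb_ends[OF cx] and Y = climb_ends[OF cy]
  have inG: "x \<in> verts G" "y \<in> verts G" using simple_graph_edgeD[OF simple xy] by auto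
  note DX = climb_distinct_in[OF cx aH inG(1)] and DY = climb_distinct_in[OF cy aH inG(2)]
  have disj: "set xs \<inter> set ys = {}"
    using climb_through_same_foot[OF cx] climb_through_same_foot[OF cy] climb_unique feet
    by (metis disjoint_iff)
  have not_tree: "{x, y} \<notin> edges T" using tree_edge_same_foot[OF H _ x cx cy] feet by blast
  define zs where "zs = rev xs @ ys"
  have ends: "hd zs = last xs" "last zs = last ys" "zs \<noteq> []"
    using X Y by (auto simp: zs_def hd_rev)
  have set_zs: "set zs = set xs \<union> set ys" by (simp add: zs_def)
  have new_edges: "consecutive_edges zs =
      insert {x, y} ((\<lambda>w. {w, p w}) ` (set zs - verts H))"
    using X Y climb_edges[OF cx] climb_edges[OF cy]
    by (auto simp: zs_def consecutive_edges_append consecutive_edges_rev last_rev)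
  have parent_edges: "(\<lambda>w. {w, p w}) ` (set zs - verts H) \<subseteq> edges T"
    using tree_edges aH DX DY set_zs by blast
  have simple_zs: "distinct zs" using DX DY disj by (simp add: zs_def)
  have sub_zs: "consecutive_edges zs \<subseteq> edges G"
    using new_edges parent_edges tree_edges_in xy by auto
  have "consecutive_edges zs - edges T = {{x, y}}"
    using new_edges parent_edges not_tree by auto
  moreover have "consecutive_edges zs \<inter> edges H = {}"
    using new_edges x simple_graph_edgeD(1)[OF simH] by auto
  moreover have "set zs \<inter> verts H = {hd zs, last zs}"
    using ends X Y by (auto simp: set_zs)
  ultimately have "ear H zs"
    unfolding ear_def using ends simple_zs sub_zs feet DX DY set_zs by simp
  moreover have "3 \<le> length zs"
  proof -
    have "{x, last xs, last ys} \<subseteq> set zs" using X Y by (auto simp: set_zs)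
    moreover have "x \<noteq> last xs" "x \<noteq> last ys" using x X Y by metis+
    then have "card {x, last xs, last ys} = 3" using feet by simp
    ultimately show ?thesis using simple_zs distinct_card card_mono finite_set by metis
  qed
  moreover have "ancestral (add_path H zs)"
  proof -
    have "subgraph (add_path H zs) G"
      using add_path_subgraph subH simple_zs sub_zs DX DY set_zs by simp
    then show ?thesis using H new_edges unfolding ancestral_def by (auto simp: add_path_def)
  qed
  ultimately show ?thesis by blast
qed

text \<open>A spanning ancestral subgraph contains all of \<open>T\<close>, so any missing edge is an ear.\<close>
lemma exists_edge_ear:
  assumes H: "ancestral H" and span: "verts G \<subseteq> verts H" and e: "e \<in> edges G" "e \<notin> edges H"
  shows "\<exists>zs. ear H zs \<and> ancestral (add_path H zs)"
proof -
  have subH: "subgraph H G" using H unfolding ancestral_def by blast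
  obtain x y where xy: "x \<in> verts G" "y \<in> verts G" "x \<noteq> y" "e = {x, y}"
    using simple e unfolding simple_graph_def by blast
  have edges_xy: "consecutive_edges [x, y] = {e}" using xy by (simp add: consecutive_edges_Cons)
  have "e \<notin> edges T" using e H span tree_edges unfolding ancestral_def by auto
  then have "ear H [x, y]"
    unfolding ear_def edges_xy using xy e span by (auto simp: insert_Diff_if)
  moreover have "ancestral (add_path H [x, y])"
  proof -
    have "subgraph (add_path H [x, y]) G"
      using add_path_subgraph[OF subH, of "[x, y]"] xy e by (simp add: edges_xy)
    moreover have "verts (add_path H [x, y]) = verts H" "edges H \<subseteq> edges (add_path H [x, y])"
      using span xy by (auto simp: add_path_def)
    ultimately show ?thesis
      using H unfolding ancestral_def by (metis subsetD)
  qed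
  ultimately show ?thesis by blast
qed

section \<open>Assembling the decomposition\<close>

text \<open>Stated for the union of the parts, which may still be smaller than \<open>G\<close>, so that it is preserved
  when one more ear is appended.\<close>
definition partial_decomposition :: "'a graph list \<Rightarrow> bool" where
  "partial_decomposition Rs \<longleftrightarrow>
     ear_decomposition (graph_Union (set Rs)) Rs \<and> (\<forall>R\<in>set Rs. card (edges R - edges T) = 1)"

lemma graph_Union_snoc:
  "graph_Union (set (Rs @ [Graph (set zs) (consecutive_edges zs)])) =
     add_path (graph_Union (set Rs)) zs"
  by (auto simp: graph_Union_def add_path_def)

lemma partial_decomposition_snoc:
  assumes Rs: "partial_decomposition Rs" and zs: "ear (graph_Union (set Rs)) zs"
  shows "partial_decomposition (Rs @ [Graph (set zs) (consecutive_edges zs)])"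
proof -
  define U where "U = graph_Union (set Rs)"
  define R where "R = Graph (set zs) (consecutive_edges zs)"
  have dec: "ear_decomposition U Rs" and card1: "\<forall>R\<in>set Rs. card (edges R - edges T) = 1"
    using Rs unfolding partial_decomposition_def U_def by auto
  have Z: "zs \<noteq> []" "distinct zs" "hd zs \<noteq> last zs" "set zs \<inter> verts U = {hd zs, last zs}"
    "consecutive_edges zs \<inter> edges U = {}" "card (consecutive_edges zs - edges T) = 1"
    using zs unfolding ear_def U_def by auto
  have simR: "simple_graph R"
    using consecutive_edges_simple[OF Z(2)] unfolding simple_graph_def R_def by simp
  have sub: "\<forall>Q\<in>set (Rs @ [R]). subgraph Q (add_path U zs)"
    using dec simR unfolding ear_decomposition_def subgraph_def R_def add_path_def by fastforce
  have cover: "edges (add_path U zs) = (\<Union>Q\<in>set (Rs @ [R]). edges Q)"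
    using dec unfolding ear_decomposition_def R_def add_path_def by auto
  have first: "is_cycle ((Rs @ [R]) ! 0)"
    using dec unfolding ear_decomposition_def by (auto simp: nth_append)
  have "\<exists>a b. a \<noteq> b \<and> is_path ((Rs @ [R]) ! i) a b \<and>
      verts ((Rs @ [R]) ! i) \<inter> verts (graph_Union (set (take i (Rs @ [R])))) = {a, b} \<and>
      edges ((Rs @ [R]) ! i) \<inter> edges (graph_Union (set (take i (Rs @ [R])))) = {}"
    if i: "0 < i" "i < length (Rs @ [R])" for i
  proof (cases "i < length Rs")
    case True
    then have "(Rs @ [R]) ! i = Rs ! i" "take i (Rs @ [R]) = take i Rs"
      by (auto simp: nth_append)
    then show ?thesis using dec True i(1) unfolding ear_decomposition_def by metis
  next
    case False
    then have "(Rs @ [R]) ! i = R" "take i (Rs @ [R]) = Rs" using i(2) by (auto simp: nth_append)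
    moreover have "is_path R (hd zs) (last zs)" using Z unfolding is_path_def R_def by blast
    ultimately show ?thesis
      using Z(3,4,5) by (intro exI[of _ "hd zs"] exI[of _ "last zs"]) (auto simp: U_def R_def)
  qed
  then have "ear_decomposition (add_path U zs) (Rs @ [R])"
    unfolding ear_decomposition_def using sub cover first by blast
  moreover have "\<forall>Q\<in>set (Rs @ [R]). card (edges Q - edges T) = 1"
    using card1 Z(6) by (auto simp: R_def)
  ultimately show ?thesis
    unfolding partial_decomposition_def U_def R_def graph_Union_snoc by blast
qed

text \<open>The ear over a single tree edge \<open>ab\<close>, closed up by \<open>ab\<close>, is the first cycle.\<close>
lemma exists_initial_cycle:
  assumes two: "two_connected G"
  shows "\<exists>C. partial_decomposition [C] \<and> ancestral (graph_Union (set [C]))"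
proof -
  have fin: "finite (verts G)" using simple unfolding simple_graph_def by blast
  have card3: "3 \<le> card (verts G)" using two unfolding two_connected_def by blast
  \<comment> \<open>A vertex of least depth other than the root is a child of the root.\<close>
  have "\<exists>v. v \<in> verts G - {a}"
  proof (rule ccontr)
    assume "\<nexists>v. v \<in> verts G - {a}"
    then have "verts G \<subseteq> {a}" by blast
    then have "card (verts G) \<le> 1" using card_mono[of "{a}" "verts G"] by simp
    then show False using card3 by simp
  qed
  then obtain b where b: "b \<in> verts G - {a}" and least: "\<And>v. v \<in> verts G - {a} \<Longrightarrow> d b \<le> d v"
    using ex_has_least_nat[of "\<lambda>v. v \<in> verts G - {a}" _ d] by blast
  have pb: "p b = a"
  proof (rule ccontr)
    assume "p b \<noteq> a"
    then have "d b \<le> d (p b)" using b parent_in least by blast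
    then show False using b parent_less[of b] by simp
  qed
  have abT: "{a, b} \<in> edges T" using b pb tree_edges by (auto simp: insert_commute)
  define H where "H = Graph {a, b} {{a, b}}"
  have "subgraph H G"
    using b root_in abT tree_edges_in unfolding subgraph_def simple_graph_def H_def by auto
  then have H: "ancestral H"
    using b pb unfolding ancestral_def by (auto simp: H_def insert_commute)
  have "\<not> verts G \<subseteq> verts H"
  proof
    assume "verts G \<subseteq> verts H"
    then have "card (verts G) \<le> card {a, b}" unfolding H_def by (auto intro: card_mono)
    also have "\<dots> \<le> 2" by (simp add: card_insert_if)
    finally show False using card3 by simp
  qed
  then obtain zs where zs: "ear H zs" "3 \<le> length zs" "ancestral (add_path H zs)"
    using exists_long_ear[OF two H] by blast
  define C where "C = Graph (set zs) (insert {last zs, hd zs} (consecutive_edges zs))"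
  have hit: "set zs \<inter> {a, b} = {hd zs, last zs}" "hd zs \<noteq> last zs" "distinct zs" "zs \<noteq> []"
    and one: "card (consecutive_edges zs - edges T) = 1"
    using zs(1) unfolding ear_def H_def by auto
  have "hd zs \<in> {a, b}" "last zs \<in> {a, b}" using hit(1) by (metis Int_iff insertCI)+
  then have ab: "{last zs, hd zs} = {a, b}" using hit(2) by (elim insertE emptyE) auto
  have Un: "graph_Union (set [C]) = add_path H zs"
  proof -
    have "set zs \<inter> {a, b} = {a, b}" using hit(1) ab by (metis insert_commute)
    then have "{a, b} \<subseteq> set zs" by (metis Int_lower1)
    then have "{a, b} \<union> set zs = set zs" by (rule Un_absorb1)
    then show ?thesis by (simp add: graph_Union_def add_path_def H_def C_def ab)
  qed
  have "is_cycle C" using zs(2) hit(3) unfolding is_cycle_def C_def by blast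
  moreover have "simple_graph C"
    unfolding C_def using hit by (intro closed_path_simple) auto
  ultimately have "ear_decomposition (graph_Union (set [C])) [C]"
    unfolding ear_decomposition_def subgraph_def by (auto simp: graph_Union_def)
  moreover have "card (edges C - edges T) = 1"
    using one ab abT by (simp add: C_def insert_Diff_if)
  ultimately show ?thesis
    using Un zs(3) unfolding partial_decomposition_def by (intro exI[of _ C]) simp
qed

text \<open>Each further ear adds an edge, so only finitely many are needed.\<close>
lemma extend_to_decomposition:
  assumes "two_connected G" "partial_decomposition Rs" "ancestral (graph_Union (set Rs))"
  shows "\<exists>Rs. ear_decomposition G Rs \<and> (\<forall>R\<in>set Rs. card (edges R - edges T) = 1)"
  using assms(2,3)
proof (induction "card (edges G - edges (graph_Union (set Rs)))" arbitrary: Rs rule: less_induct)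
  case less
  define H where "H = graph_Union (set Rs)"
  have dec: "ear_decomposition H Rs" and card1: "\<forall>R\<in>set Rs. card (edges R - edges T) = 1"
    using less.prems(1) unfolding partial_decomposition_def H_def by auto
  have anc: "ancestral H" using less.prems(2) H_def by simp
  then have subH: "subgraph H G" unfolding ancestral_def by blast
  show ?case
  proof (cases "edges G \<subseteq> edges H")
    case True
    then have "edges G = edges H" using subH unfolding subgraph_def by blast
    moreover have "\<forall>R\<in>set Rs. subgraph R G"
      using dec subH unfolding ear_decomposition_def subgraph_def by blast
    ultimately have "ear_decomposition G Rs"
      using dec unfolding ear_decomposition_def by simp
    then show ?thesis using card1 by blast
  next
    case False
    then obtain zs where zs: "ear H zs" "ancestral (add_path H zs)"
      using exists_long_ear[OF assms(1) anc] exists_edge_ear[OF anc] by blast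
    define Rs' where "Rs' = Rs @ [Graph (set zs) (consecutive_edges zs)]"
    have U: "graph_Union (set Rs') = add_path H zs"
      unfolding Rs'_def graph_Union_snoc H_def ..
    have "partial_decomposition Rs'"
      unfolding Rs'_def using partial_decomposition_snoc less.prems(1) zs(1) H_def by blast
    moreover have "consecutive_edges zs \<noteq> {}" "consecutive_edges zs \<inter> edges H = {}"
      "consecutive_edges zs \<subseteq> edges G"
      using zs(1) unfolding ear_def by auto
    then have "edges G - edges (add_path H zs) \<subset> edges G - edges H"
      by (auto simp: add_path_def)
    then have "card (edges G - edges (add_path H zs)) < card (edges G - edges H)"
      using simple_graph_finite_edges[OF simple] by (intro psubset_card_mono) auto
    ultimately show ?thesis using less.hyps[of Rs'] zs(2) U unfolding H_def by simp
  qed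
qed

end

theorem theorem7p2:
  fixes G T :: "'a graph"
  assumes "simple_graph G" and "two_connected G" and "spanning_tree T G"
  shows "\<exists>Rs. ear_decomposition G Rs \<and>
           (\<forall>i<length Rs. card (edges (Rs ! i) - edges T) = 1)"
proof -
  have T: "tree T" "verts T = verts G" "edges T \<subseteq> edges G"
    using assms(3) unfolding spanning_tree_def subgraph_def by auto
  obtain a where a: "a \<in> verts G"
    using assms(2) unfolding two_connected_def connected_graph_def by blast
  obtain p and d :: "'a \<Rightarrow> nat" where
    "\<And>v. v \<in> verts G \<Longrightarrow> v \<noteq> a \<Longrightarrow> d (p v) < d v"
    "edges T = (\<lambda>v. {v, p v}) ` (verts G - {a})"
    using tree_parent_function[OF T(1), of a] a T(2) by metis
  then interpret rooted_spanning_tree G T a p d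
    using assms(1) T(3) a by unfold_locales auto
  obtain C where "partial_decomposition [C]" "ancestral (graph_Union (set [C]))"
    using exists_initial_cycle[OF assms(2)] by blast
  from extend_to_decomposition[OF assms(2) this] show ?thesis
    using nth_mem by blast
qed

end
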